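(* Let $q$ be any prime power and let $n\ge 0$ be an integer. Then, in $K_\infty=\mathbb{F}_q((1/t))$, $$\zeta\big(1,\ q-1,\ (q-1)q,\ \dots,\ (q-1)q^n\big)=\frac{(-1)^{n+1}}{[1]^{q^n}\,[2]^{q^{n-1}}\cdots[n+1]^{q^0}}\ \zeta(q^{n+1}),$$ where the tuple on the left has the $n+2$ entries $1$ and $(q-1)q^i$ for $i=0,1,\dots,n$ in this order, and the denominator on the right is $\prod_{i=1}^{n+1}[i]^{q^{n+1-i}}$.
   Context: Let $q$ be a power of a prime, $A=\mathbb{F}_q[t]$, $K=\mathbb{F}_q(t)$, and $K_\infty=\mathbb{F}_q((1/t))$ the completion of $K$ at the place $\infty$. For $d\ge 0$, let $A_{d^+}$ be the set of monic polynomials of degree $d$ in $A$. For an integer $m\ge 1$ put $[m]=t^{q^m}-t$. For positive integers $s$ and $d\ge 0$, put $S_d(s)=\sum_{a\in A_{d^+}} a^{-s}\in K$. For positive integers $s_1,\dots,s_r$ ($r\ge 1$), the multizeta value is $$\zeta(s_1,\dots,s_r)=\sum_{d_1>\cdots>d_r\ge 0}S_{d_1}(s_1)\cdots S_{d_r}(s_r)\in K_\infty,$$ i.e. the sum of $a_1^{-s_1}\cdots a_r^{-s_r}$ over monic $a_i\in A$ with $\deg a_1>\cdots>\deg a_r\ge 0$ (convergent in $K_\infty$). For $r=1$ this is the Carlitz zeta value $\zeta(s)=\sum_{d\ge 0}S_d(s)$. *)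

theory Defs
  imports
    "HOL-Library.Cardinality"
    "HOL-Analysis.Infinite_Sum"
    "HOL-Computational_Algebra.Formal_Laurent_Series"
begin

text \<open>
  The field \<open>F\<^sub>q\<close> is a type \<open>'a\<close> of sort \<open>{field, finite}\<close>, with \<open>q = CARD('a)\<close>, and
  \<open>A = F\<^sub>q[t]\<close> is \<^typ>\<open>'a poly\<close>. The completion \<open>F\<^sub>q((1/t))\<close> is \<^typ>\<open>'a fls\<close> with its library
  metric; the formal variable \<^const>\<open>fls_X\<close> is \<open>1/t\<close>, so \<open>t\<close> is \<^const>\<open>fls_X_inv\<close>.
  All values that lie in \<open>K = F\<^sub>q(t)\<close> are formed inside \<^typ>\<open>'a fls\<close>.
\<close>

abbreviation tvar :: "'a::field fls"
  where "tvar \<equiv> fls_X_inv"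

definition poly_embed :: "'a::field poly \<Rightarrow> 'a fls"
  where "poly_embed a = poly (map_poly fls_const a) tvar"

definition monic_polys :: "nat \<Rightarrow> 'a::field poly set"
  where "monic_polys d = {a. lead_coeff a = 1 \<and> degree a = d}"

definition bracket :: "nat \<Rightarrow> 'a::{field,finite} fls"
  where "bracket m = tvar ^ (CARD('a) ^ m) - tvar"

definition power_sum :: "nat \<Rightarrow> nat \<Rightarrow> 'a::{field,finite} fls"
  where "power_sum d s = (\<Sum>a\<in>monic_polys d. 1 / poly_embed a ^ s)"

definition decreasing_lists :: "nat \<Rightarrow> nat list set"
  where "decreasing_lists r = {ds. length ds = r \<and> sorted_wrt (>) ds}"

definition multizeta_term :: "nat list \<Rightarrow> nat list \<Rightarrow> 'a::{field,finite} fls"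
  where "multizeta_term s ds = (\<Prod>i<length s. power_sum (ds ! i) (s ! i))"

text \<open>
  \<^const>\<open>infsum\<close> is the unconditional sum, and is \<open>0\<close> by convention if there is none.
  The lemma \<open>multizeta_summable\<close> below shows that the sum exists for all positive exponents.
\<close>

definition multizeta :: "nat list \<Rightarrow> 'a::{field,finite} fls"
  where "multizeta s = (\<Sum>\<^sub>\<infinity>ds\<in>decreasing_lists (length s). multizeta_term s ds)"


unbundle fps_syntax


subsection \<open>Finiteness of the sums over monic polynomials\<close>

lemma finite_monic_polys: "finite (monic_polys d :: 'a::{field,finite} poly set)"
proof (rule finite_subset)
  show "monic_polys d \<subseteq> Poly ` {xs :: 'a list. set xs \<subseteq> UNIV \<and> length xs = Suc d}"
  proof
    fix p :: "'a poly" assume "p \<in> monic_polys d"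
    hence p: "degree p = d" "p \<noteq> 0" by (auto simp: monic_polys_def)
    have "p = Poly (coeffs p)" by simp
    moreover have "length (coeffs p) = Suc d" using p by (simp add: length_coeffs)
    ultimately show "p \<in> Poly ` {xs. set xs \<subseteq> UNIV \<and> length xs = Suc d}" by blast
  qed
  show "finite (Poly ` {xs :: 'a list. set xs \<subseteq> UNIV \<and> length xs = Suc d})"
    by (intro finite_imageI finite_lists_length_eq) simp
qed


subsection \<open>Convergence of multizeta values\<close>

lemma poly_embed_nth: "poly_embed a $$ k = (if k \<le> 0 then coeff a (nat (-k)) else 0)"
proof -
  have "poly_embed a = (\<Sum>i\<le>degree a. fls_const (coeff a i) * fls_X_inv ^ i)"
    by (simp add: poly_embed_def poly_altdef degree_map_poly coeff_map_poly)
  hence "poly_embed a $$ k = (\<Sum>i\<le>degree a. coeff a i * (if k = - int i then 1 else 0))"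
    by (simp add: fls_nth_sum)
  also have "\<dots> = (\<Sum>i\<le>degree a. if i = nat (-k) \<and> k \<le> 0 then coeff a i else 0)"
    by (intro sum.cong) auto
  also have "\<dots> = (if k \<le> 0 then coeff a (nat (-k)) else 0)"
    by (auto simp: sum.delta coeff_eq_0)
  finally show ?thesis .
qed

lemma poly_embed_subdegree:
  assumes "a \<noteq> 0"
  shows "poly_embed a \<noteq> 0" "fls_subdegree (poly_embed a) = - int (degree a)"
proof -
  have "poly_embed a $$ (- int (degree a)) \<noteq> 0"
    using assms by (simp add: poly_embed_nth)
  thus "poly_embed a \<noteq> 0" by auto
  show "fls_subdegree (poly_embed a) = - int (degree a)"
    by (rule fls_subdegree_eqI) (use assms in \<open>auto simp: poly_embed_nth coeff_eq_0\<close>)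
qed

lemma power_sum_nth_eq_0:
  assumes "k < int (d * s)"
  shows "(power_sum d s :: 'a::{field,finite} fls) $$ k = 0"
proof -
  have "(1 / poly_embed a ^ s) $$ k = 0" if "a \<in> monic_polys d" for a :: "'a poly"
  proof -
    have a: "a \<noteq> 0" "degree a = d" using that by (auto simp: monic_polys_def)
    have "fls_subdegree (1 / poly_embed a ^ s) = int (d * s)"
      using poly_embed_subdegree[OF a(1)] a(2)
      by (simp add: fls_divide_subdegree fls_subdegree_pow)
    thus ?thesis using assms by simp
  qed
  thus ?thesis by (simp add: power_sum_def fls_nth_sum)
qed

lemma fls_summable_onI:
  fixes f :: "'b \<Rightarrow> 'a::field fls"
  assumes nonneg: "\<And>x k. x \<in> A \<Longrightarrow> k < 0 \<Longrightarrow> f x $$ k = 0"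
    and fin: "\<And>N::nat. finite {x\<in>A. \<exists>k<int N. f x $$ k \<noteq> 0}"
  shows "f summable_on A"
proof -
  define c where "c k = (\<Sum>x | x \<in> A \<and> f x $$ k \<noteq> 0. f x $$ k)" for k
  define S where "S = fps_to_fls (Abs_fps (\<lambda>k. c (int k)))"
  have S: "S $$ k = c k" for k
    using nonneg by (auto simp: S_def c_def intro!: sum.neutral[symmetric])
  have "(f has_sum S) A"
    unfolding has_sum_def
  proof (rule tendstoI)
    fix e :: real assume "e > 0"
    then obtain N :: nat where N: "inverse (2 ^ N) < e"
      using real_arch_pow_inv[of e "1/2"] by (auto simp: power_one_over inverse_eq_divide)
    let ?X = "{x\<in>A. \<exists>k<int N. f x $$ k \<noteq> 0}"
    show "\<forall>\<^sub>F F in finite_subsets_at_top A. dist (sum f F) S < e"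
      unfolding eventually_finite_subsets_at_top
    proof (intro exI conjI allI impI)
      show "finite ?X" by (rule fin)
      show "?X \<subseteq> A" by auto
      fix F assume F: "finite F \<and> ?X \<subseteq> F \<and> F \<subseteq> A"
      have eq: "(sum f F - S) $$ k = 0" if "k < int N" for k
      proof -
        have "c k = (\<Sum>x\<in>F. f x $$ k)"
          unfolding c_def by (rule sum.mono_neutral_left) (use F that in auto)
        thus ?thesis by (simp add: S fls_nth_sum)
      qed
      show "dist (sum f F) S < e"
      proof (cases "sum f F = S")
        case False
        hence "fls_subdegree (sum f F - S) \<ge> int N"
          by (intro fls_subdegree_geI) (use eq in auto)
        moreover from this have "inverse (2 ^ nat (fls_subdegree (sum f F - S))) \<le> inverse ((2::real) ^ N)"
          by (intro le_imp_inverse_le power_increasing) auto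
        ultimately have "fls_subdegree (sum f F - S) \<ge> 0"
          and "inverse (2 ^ nat (fls_subdegree (sum f F - S))) < e"
          using N by linarith+
        thus ?thesis using False by (simp add: dist_fls_def)
      qed (use \<open>e > 0\<close> in simp)
    qed
  qed
  thus ?thesis by (auto simp: summable_on_def)
qed

lemma fls_prod_nth_eq_0:
  fixes g :: "'b \<Rightarrow> 'a::field fls"
  assumes "finite I" "\<And>i k. i \<in> I \<Longrightarrow> k < int (m i) \<Longrightarrow> g i $$ k = 0" "k < int (\<Sum>i\<in>I. m i)"
  shows "(\<Prod>i\<in>I. g i) $$ k = 0"
proof -
  have "(\<Prod>i\<in>I. g i) = 0 \<or> fls_subdegree (\<Prod>i\<in>I. g i) \<ge> int (\<Sum>i\<in>I. m i)"
    using assms(1,2)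
  proof (induction I rule: finite_induct)
    case (insert i I)
    have "g i = 0 \<or> fls_subdegree (g i) \<ge> int (m i)"
      using insert.prems[of i] by (auto intro!: fls_subdegree_geI)
    moreover have "(\<Prod>i\<in>I. g i) = 0 \<or> fls_subdegree (\<Prod>i\<in>I. g i) \<ge> int (\<Sum>i\<in>I. m i)"
      by (rule insert.IH) (use insert.prems in auto)
    ultimately show ?case
      by (cases "g i = 0 \<or> (\<Prod>i\<in>I. g i) = 0") (use insert.hyps in auto)
  qed simp
  thus ?thesis using assms(3) by auto
qed

lemma multizeta_term_nth_eq_0:
  assumes "\<forall>x\<in>set s. x > 0" "k < int (\<Sum>i<length s. ds ! i)"
  shows "multizeta_term s ds $$ k = 0"
  unfolding multizeta_term_def
proof (rule fls_prod_nth_eq_0[OF _ _ assms(2)])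
  fix i k assume "i \<in> {..<length s}" "k < int (ds ! i)"
  moreover from this have "s ! i > 0" using assms(1) by simp
  ultimately have "k < int (ds ! i * s ! i)"
    by (smt (verit) mult_le_mono2 nat_mult_1_right of_nat_mono Suc_leI One_nat_def)
  thus "power_sum (ds ! i) (s ! i) $$ k = 0" by (rule power_sum_nth_eq_0)
qed simp

lemma multizeta_summable:
  assumes "\<forall>x\<in>set s. x > 0"
  shows "(multizeta_term s :: _ \<Rightarrow> 'a::{field,finite} fls) summable_on decreasing_lists (length s)"
proof (rule fls_summable_onI)
  fix ds k assume "k < (0::int)"
  thus "(multizeta_term s ds :: 'a fls) $$ k = 0"
    by (intro multizeta_term_nth_eq_0[OF assms] order_less_le_trans[OF _ of_nat_0_le_iff])
next
  fix N :: nat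
  show "finite {ds \<in> decreasing_lists (length s). \<exists>k<int N. (multizeta_term s ds :: 'a fls) $$ k \<noteq> 0}"
  proof (rule finite_subset)
    show "finite {ds. set ds \<subseteq> {..N} \<and> length ds = length s}"
      by (rule finite_lists_length_eq) simp
    show "{ds \<in> decreasing_lists (length s). \<exists>k<int N. (multizeta_term s ds :: 'a fls) $$ k \<noteq> 0}
      \<subseteq> {ds. set ds \<subseteq> {..N} \<and> length ds = length s}"
    proof clarify
      fix ds k assume ds: "ds \<in> decreasing_lists (length s)"
        and k: "k < int N" "(multizeta_term s ds :: 'a fls) $$ k \<noteq> 0"
      have len: "length ds = length s" using ds by (simp add: decreasing_lists_def)
      have le: "int (\<Sum>i<length s. ds ! i) \<le> k"
        using k(2) multizeta_term_nth_eq_0[OF assms] by (metis not_le)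
      have "x \<le> N" if x: "x \<in> set ds" for x
      proof -
        obtain i where "i < length s" "x = ds ! i"
          using x len by (metis in_set_conv_nth)
        hence "x \<le> (\<Sum>i<length s. ds ! i)" by (auto intro: member_le_sum)
        thus ?thesis using le k(1) by linarith
      qed
      thus "set ds \<subseteq> {..N} \<and> length ds = length s" using len by auto
    qed
  qed
qed

unbundle no fps_syntax

end

theory Submission
  imports Defs
begin

text \<open>
  Let e_d(x) be the product of x - b over all polynomials b of degree less than d. It is additive,
  and the recursion e_{d+1} = e_d^q - D_d^{q-1} e_d with D_d = e_d(t^d) shows by induction on d that
  the sum of 1/(y + b)^k over these b is (c_d / e_d(y))^k for k = 1 and k = q - 1, where c_d is the
  linear coefficient of e_d. At y = t^d this gives S_d(k) = 1 / l_d^k with l_d = (-1)^d [1]...[d],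
  and Frobenius gives S_d(k q^i) = 1 / l_d^(k q^i). With S_{<d} denoting the part d_1 < d of a
  multizeta sum and C_n = (-1)^n / prod_{i=1..n} [i]^(q^(n-i)), the sums
  S_{<d}(q-1, (q-1)q, ..., (q-1)q^(n-1)) then telescope to C_n l_d / l_{d-n}^(q^n). Multiplying by
  S_d(1) = 1 / l_d leaves C_n S_{d-n}(q^n), and summing over d gives the theorem.
\<close>

section \<open>The Frobenius map\<close>

text \<open>
  The library has this for the class \<^class>\<open>finite_field\<close>, which the sort \<open>{field, finite}\<close>
  does not entail for the type checker.
\<close>

lemma power_card_eq_same:
  fixes x :: "'a::{field,finite}"
  shows "x ^ CARD('a) = x"
proof (cases "x = 0")
  case False
  have "(\<Prod>y\<in>UNIV-{0}. x * y) = \<Prod>(UNIV-{0})"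
    by (rule prod.reindex_bij_witness[of _ "\<lambda>y. y / x" "\<lambda>y. x * y"]) (use False in auto)
  hence "x ^ (CARD('a) - 1) = 1"
    by (simp add: prod.distrib card_Diff_singleton)
  thus ?thesis
    using power_Suc[of x "CARD('a) - 1"] zero_less_card_finite[where 'a='a] by simp
qed simp

text \<open>Translation by 1 permutes the field, so the \<open>q\<close> added ones sum to
  0.\<close>

lemma of_nat_card_eq_0: "of_nat CARD('a) = (0 :: 'a::{field,finite})"
proof -
  have "(\<Sum>x\<in>UNIV. x + 1) = (\<Sum>x\<in>(UNIV::'a set). x)"
    by (rule sum.reindex_bij_witness[of _ "\<lambda>y. y - 1" "\<lambda>y. y + 1"]) auto
  thus ?thesis by (simp add: sum.distrib)
qed

lemma card_gt_1: "1 < CARD('a::{field,finite})"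
proof -
  have "card {0, 1 :: 'a} \<le> CARD('a)" by (intro card_mono) auto
  thus ?thesis by simp
qed

lemma power_card_unfold: "x * x ^ (CARD('a) - 1) = (x :: 'a::{field,finite} fls) ^ CARD('a)"
  using card_gt_1[where 'a='a] by (simp flip: power_Suc)

lemma fls_of_nat_card_eq_0: "of_nat CARD('a) = (0 :: 'a::{field,finite} fls)"
  by (simp add: fls_of_nat of_nat_card_eq_0)

lemma fls_const_power_card: "fls_const c ^ CARD('a) = fls_const (c :: 'a::{field,finite})"
  by (simp add: power_card_eq_same flip: fls_const_power)

lemma inj_fls_const: "inj fls_const"
  by (rule injI) (metis fls_const_nth)

text \<open>The difference of \<open>p\<close> and \<open>r\<close> has degree below
  \<open>q\<close> but vanishes at the \<open>q\<close> constants.\<close>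

lemma poly_eqI_fls_const:
  fixes p r :: "'a::{field,finite} fls poly"
  assumes "coeff p CARD('a) = coeff r CARD('a)" "degree p \<le> CARD('a)" "degree r \<le> CARD('a)"
    and "\<And>c. poly p (fls_const c) = poly r (fls_const c)"
  shows "p = r"
  by (rule poly_eqI_degree_lead_coeff[where A = "range fls_const"])
     (use assms in \<open>auto simp: card_image inj_fls_const\<close>)

lemma degree_linear_power_le: "degree ([:a, 1:] ^ n) \<le> n" for a :: "'a::comm_ring_1"
  using degree_power_le[of "[:a, 1:]" n] by (simp add: le_trans split: if_splits)

text \<open>For fixed \<open>x\<close> both sides are polynomials in \<open>y\<close> of degree
  \<open>q\<close> with equal top coefficient, so agreement at constant \<open>y\<close>
  suffices.\<close>

lemma fls_add_power_card:
  fixes x y :: "'a::{field,finite} fls"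
  shows "(x + y) ^ CARD('a) = x ^ CARD('a) + y ^ CARD('a)"
proof -
  let ?q = "CARD('a)"
  have *: "(x + y) ^ ?q = x ^ ?q + y ^ ?q"
    if "\<And>c. (x + fls_const c) ^ ?q = x ^ ?q + fls_const c" for x y :: "'a fls"
  proof -
    have "[:x, 1:] ^ ?q = monom 1 ?q + [:x ^ ?q:]"
    proof (rule poly_eqI_fls_const)
      show "degree (monom 1 ?q + [:x ^ ?q:]) \<le> ?q"
        by (intro degree_add_le degree_monom_le) simp
      show "coeff ([:x, 1:] ^ ?q) ?q = coeff (monom 1 ?q + [:x ^ ?q:]) ?q"
        using card_gt_1[where 'a='a] by (simp add: coeff_linear_power coeff_pCons split: nat.splits)
    qed (use that in \<open>simp_all add: degree_linear_power_le poly_monom fls_const_power_card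
          algebra_simps poly_power\<close>)
    hence "poly ([:x, 1:] ^ ?q) y = poly (monom 1 ?q + [:x ^ ?q:]) y" by simp
    thus ?thesis by (simp add: poly_monom algebra_simps poly_power)
  qed
  \<comment> \<open>The first use of \<open>*\<close> takes \<open>x\<close> constant; its result,
    with the summands swapped, is the premise of the second use at arbitrary
    \<open>x\<close>.\<close>
  have "(fls_const c + y) ^ ?q = fls_const c ^ ?q + y ^ ?q"
    for c and y :: "'a fls"
    by (rule *) (simp add: fls_plus_const fls_const_power_card)
  thus ?thesis
    by (intro *) (simp add: add.commute fls_const_power_card)
qed

lemma fls_minus_power_card: "(- x) ^ CARD('a) = - (x ^ CARD('a))" for x :: "'a::{field,finite} fls"
proof -
  have "x ^ CARD('a) + (- x) ^ CARD('a) = 0"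
    using fls_add_power_card[of x "- x"] by (simp add: power_0_left)
  thus ?thesis by (simp add: add_eq_0_iff)
qed

lemma fls_diff_power_card:
  "(x - y) ^ CARD('a) = x ^ CARD('a) - y ^ CARD('a)" for x y :: "'a::{field,finite} fls"
  using fls_add_power_card[of x "- y"] by (simp add: fls_minus_power_card)

lemma fls_diff_power_card_power:
  "(x - y) ^ (CARD('a) ^ k) = x ^ (CARD('a) ^ k) - y ^ (CARD('a) ^ k)"
  for x y :: "'a::{field,finite} fls"
  by (induction k) (simp_all add: power_mult mult.commute[of "CARD('a)"] fls_diff_power_card)

lemma fls_sum_power_card:
  "(\<Sum>i\<in>I. f i) ^ CARD('a) = (\<Sum>i\<in>I. f i ^ CARD('a) :: 'a::{field,finite} fls)"
  by (induction I rule: infinite_finite_induct) (simp_all add: fls_add_power_card)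

lemma fls_sum_power_card_power:
  "(\<Sum>i\<in>I. f i) ^ (CARD('a) ^ k) = (\<Sum>i\<in>I. f i ^ (CARD('a) ^ k) :: 'a::{field,finite} fls)"
  by (induction k) (simp_all add: power_mult mult.commute[of "CARD('a)"] fls_sum_power_card)


section \<open>Sums over the constants\<close>

text \<open>Both sides are monic of degree \<open>q\<close> and vanish at every constant.\<close>

lemma prod_linear_fls_const:
  "(\<Prod>c\<in>UNIV. [:fls_const c, 1:]) = monom 1 CARD('a) - [:0, 1 :: 'a::{field,finite} fls:]"
    (is "?P = ?R")
proof (rule poly_eqI_fls_const)
  have deg: "degree ?P = CARD('a)"
    by (subst degree_prod_eq_sum_degree) auto
  have "lead_coeff ?P = 1"
    by (subst lead_coeff_prod) simp
  thus "coeff ?P CARD('a) = coeff ?R CARD('a)"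
    using card_gt_1[where 'a='a] deg by (simp add: coeff_pCons split: nat.splits)
  show "degree ?P \<le> CARD('a)" using deg by simp
  show "degree ?R \<le> CARD('a)"
    using card_gt_1[where 'a='a] by (intro degree_diff_le degree_monom_le) simp
  fix c :: 'a
  have "poly ?P (fls_const c) = (\<Prod>a\<in>UNIV. fls_const (a + c))"
    by (simp add: poly_prod fls_plus_const)
  also have "\<dots> = 0" by (intro prod_zero bexI[of _ "- c"]) auto
  finally show "poly ?P (fls_const c) = poly ?R (fls_const c)"
    by (simp add: poly_monom fls_const_power_card)
qed

lemma add_fls_const_nonzero:
  fixes u :: "'a::{field,finite} fls"
  assumes "u ^ CARD('a) \<noteq> u"
  shows "u + fls_const c \<noteq> 0"
proof
  assume "u + fls_const c = 0"
  hence "u = fls_const (- c)" by (simp add: add_eq_0_iff2)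
  thus False using assms fls_const_power_card[of "- c"] by simp
qed

text \<open>This is the logarithmic derivative of \<open>X\<^sup>q - X\<close>, the product of all \<open>X + c\<close>.\<close>

lemma sum_inverse_add_fls_const:
  fixes u :: "'a::{field,finite} fls"
  assumes u: "u ^ CARD('a) \<noteq> u"
  shows "(\<Sum>c\<in>UNIV. 1 / (u + fls_const c)) = - 1 / (u ^ CARD('a) - u)"
proof -
  let ?P = "\<lambda>c. [:fls_const c, 1 :: 'a fls:]"
  have "-1 = poly (pderiv (\<Prod>c\<in>UNIV. ?P c)) u"
    unfolding prod_linear_fls_const by (simp add: pderiv_diff pderiv_monom fls_of_nat_card_eq_0 pderiv_pCons)
  also have "\<dots> = (\<Sum>c\<in>UNIV. poly (\<Prod>c\<in>UNIV-{c}. ?P c) u)"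
    by (simp add: pderiv_prod poly_sum pderiv_pCons)
  also have "\<dots> = (\<Sum>c\<in>UNIV. (u ^ CARD('a) - u) * (1 / (u + fls_const c)))"
  proof (rule sum.cong)
    fix c :: 'a
    have "poly (\<Prod>c\<in>UNIV. ?P c) u = (u + fls_const c) * poly (\<Prod>c\<in>UNIV-{c}. ?P c) u"
      by (subst prod.remove[of _ c]) (simp_all add: algebra_simps)
    hence "u ^ CARD('a) - u = (u + fls_const c) * poly (\<Prod>c\<in>UNIV-{c}. ?P c) u"
      unfolding prod_linear_fls_const by (simp add: poly_monom)
    thus "poly (\<Prod>c\<in>UNIV-{c}. ?P c) u = (u ^ CARD('a) - u) * (1 / (u + fls_const c))"
      using add_fls_const_nonzero[OF u, of c] by simp
  qed simp
  finally have "-1 = (u ^ CARD('a) - u) * (\<Sum>c\<in>UNIV. 1 / (u + fls_const c))"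
    by (simp add: sum_distrib_left)
  thus ?thesis using u by (simp add: field_simps)
qed

text \<open>Writing \<open>1 / w\<^sup>q\<^sup>-\<^sup>1\<close> as \<open>w / w\<^sup>q\<close> makes the denominators \<open>u\<^sup>q + c\<close>.\<close>

lemma sum_inverse_power_add_fls_const:
  fixes u :: "'a::{field,finite} fls"
  assumes u: "u ^ CARD('a) \<noteq> u"
  shows "(\<Sum>c\<in>UNIV. 1 / (u + fls_const c) ^ (CARD('a) - 1)) = 1 / (u ^ CARD('a) - u) ^ (CARD('a) - 1)"
proof -
  let ?q = "CARD('a)" and ?w = "u ^ CARD('a) - u"
  have wq: "(u ^ ?q) ^ ?q - u ^ ?q = ?w ^ ?q"
    by (simp add: fls_diff_power_card)
  hence uq: "(u ^ ?q) ^ ?q \<noteq> u ^ ?q" using u by auto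
  have "1 / (u + fls_const c) ^ (?q - 1) = 1 - ?w * (1 / (u ^ ?q + fls_const c))" for c
  proof -
    have "1 / (u + fls_const c) ^ (?q - 1) = (u + fls_const c) / (u + fls_const c) ^ ?q"
      using add_fls_const_nonzero[OF u, of c] by (simp flip: power_card_unfold)
    also have "(u + fls_const c) ^ ?q = u ^ ?q + fls_const c"
      by (simp add: fls_add_power_card fls_const_power_card)
    also have "(u + fls_const c) / \<dots> = 1 - ?w * (1 / (u ^ ?q + fls_const c))"
      using add_fls_const_nonzero[OF uq, of c] by (simp add: field_simps)
    finally show ?thesis .
  qed
  \<comment> \<open>The constant 1 is summed \<open>q\<close> times and so contributes 0.\<close>
  hence "(\<Sum>c\<in>UNIV. 1 / (u + fls_const c) ^ (?q - 1)) = - ?w * (\<Sum>c\<in>UNIV. 1 / (u ^ ?q + fls_const c))"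
    by (simp only: sum_subtractf sum_constant fls_of_nat_card_eq_0 mult_minus_left
          flip: sum_distrib_left) simp
  also have "\<dots> = ?w / ?w ^ ?q"
    by (simp only: sum_inverse_add_fls_const[OF uq] wq divide_minus_left minus_mult_minus
          times_divide_eq_right mult_1_right)
  also have "\<dots> = 1 / ?w ^ (?q - 1)"
    using u by (simp flip: power_card_unfold)
  finally show ?thesis .
qed

lemma minus_one_power_card_minus_1: "(- 1) ^ (CARD('a) - 1) = (1 :: 'a::{field,finite} fls)"
proof -
  have "(- 1) ^ CARD('a) = (- 1 :: 'a fls)" by (simp add: fls_minus_power_card)
  moreover have "(- 1) * (- 1 :: 'a fls) ^ (CARD('a) - 1) = (- 1) ^ CARD('a)"
    by (rule power_card_unfold)
  ultimately show ?thesis by simp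
qed

text \<open>Factoring out \<open>Z\<close> reduces this to the sums at \<open>u = Y / Z\<close>;
  since \<open>(- 1) ^ (q - 1) = 1\<close>, one formula fits both exponents. With
  \<open>Y = carlitz_e d y\<close> and \<open>Z = carlitz_D d\<close> the denominator is
  \<open>carlitz_e (Suc d) y\<close>.\<close>

lemma sum_inverse_power_add_const_mult:
  fixes Y Z :: "'a::{field,finite} fls"
  assumes Z: "Z \<noteq> 0" and YZ: "Y ^ CARD('a) - Z ^ (CARD('a) - 1) * Y \<noteq> 0"
    and k: "k = 1 \<or> k = CARD('a) - 1"
  shows "(\<Sum>c\<in>UNIV. 1 / (Y + fls_const c * Z) ^ k) =
    (- (Z ^ (CARD('a) - 1)) / (Y ^ CARD('a) - Z ^ (CARD('a) - 1) * Y)) ^ k"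
proof -
  let ?q = "CARD('a)" and ?u = "Y / Z"
  have Zq: "Z ^ ?q = Z * Z ^ (?q - 1)"
    by (simp only: power_card_unfold)
  have w: "?u ^ ?q - ?u = (Y ^ ?q - Z ^ (?q - 1) * Y) / (Z * Z ^ (?q - 1))"
    using Z by (simp add: power_divide Zq field_simps)
  hence u: "?u ^ ?q \<noteq> ?u" using YZ Z by auto
  have "Y + fls_const c * Z = Z * (?u + fls_const c)" for c
    using Z by (simp add: field_simps)
  hence "(\<Sum>c\<in>UNIV. 1 / (Y + fls_const c * Z) ^ k) = 1 / Z ^ k * (\<Sum>c\<in>UNIV. 1 / (?u + fls_const c) ^ k)"
    by (simp add: power_mult_distrib sum_distrib_left)
  also have "(\<Sum>c\<in>UNIV. 1 / (?u + fls_const c) ^ k) = (- 1 / (?u ^ ?q - ?u)) ^ k"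
    using k
  proof
    assume "k = ?q - 1"
    thus ?thesis using sum_inverse_power_add_fls_const[OF u]
      by (simp only: power_divide[of "- 1"] minus_one_power_card_minus_1)
  qed (use sum_inverse_add_fls_const[OF u] in simp)
  also have "1 / Z ^ k * (- 1 / (?u ^ ?q - ?u)) ^ k = (1 / Z * (- 1 / (?u ^ ?q - ?u))) ^ k"
    by (simp only: power_mult_distrib power_divide power_one)
  also have "1 / Z * (- 1 / (?u ^ ?q - ?u)) = - (Z ^ (?q - 1)) / (Y ^ ?q - Z ^ (?q - 1) * Y)"
    unfolding w using Z YZ by (simp add: field_simps)
  finally show ?thesis .
qed

section \<open>Carlitz polynomials and power sums\<close>

text \<open>The coefficient of \<open>t\<close>, at index -1, is -1 because
  \<open>q ^ m > 1\<close>.\<close>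

lemma bracket_nonzero:
  assumes "m > 0"
  shows "bracket m \<noteq> (0 :: 'a::{field,finite} fls)"
proof -
  have "CARD('a) ^ m > 1"
    using card_gt_1[where 'a='a] assms by (intro one_less_power) auto
  hence "int CARD('a) ^ m \<noteq> 1"
    by (metis of_nat_eq_1_iff of_nat_power less_irrefl)
  hence "fls_nth (bracket m :: 'a fls) (- 1) = - 1"
    by (auto simp: bracket_def)
  thus ?thesis by auto
qed

text \<open>
  \<open>carlitz_e d\<close> is \<open>\<Prod>(x - b)\<close> over all polynomials \<open>b\<close> of degree less than \<open>d\<close>; its linear
  coefficient is \<open>carlitz_c d\<close>, and \<open>carlitz_D d\<close> is its value at \<open>t\<^sup>d\<close>.
\<close>

primrec carlitz_D :: "nat \<Rightarrow> 'a::{field,finite} fls" where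
  "carlitz_D 0 = 1"
| "carlitz_D (Suc d) = bracket (Suc d) * carlitz_D d ^ CARD('a)"

primrec carlitz_e :: "nat \<Rightarrow> 'a::{field,finite} fls \<Rightarrow> 'a fls" where
  "carlitz_e 0 x = x"
| "carlitz_e (Suc d) x =
     carlitz_e d x ^ CARD('a) - carlitz_D d ^ (CARD('a) - 1) * carlitz_e d x"

primrec carlitz_c :: "nat \<Rightarrow> 'a::{field,finite} fls" where
  "carlitz_c 0 = 1"
| "carlitz_c (Suc d) = - (carlitz_D d ^ (CARD('a) - 1)) * carlitz_c d"

definition carlitz_ell :: "nat \<Rightarrow> 'a::{field,finite} fls" where
  "carlitz_ell d = (\<Prod>i=1..d. - bracket i)"

lemma carlitz_ell_0 [simp]: "carlitz_ell 0 = 1"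
  by (simp add: carlitz_ell_def)

lemma carlitz_ell_Suc: "carlitz_ell (Suc d) = - bracket (Suc d) * carlitz_ell d"
  by (simp add: carlitz_ell_def)

lemma carlitz_ell_nonzero [simp]: "carlitz_ell d \<noteq> 0"
  by (induction d) (simp_all add: carlitz_ell_Suc bracket_nonzero)

lemma carlitz_D_nonzero [simp]: "carlitz_D d \<noteq> 0"
  by (induction d) (simp_all add: bracket_nonzero)

text \<open>This turns the quotient \<open>carlitz_c d / carlitz_D d\<close> arising in the power
  sums into \<open>1 / carlitz_ell d\<close>.\<close>

lemma carlitz_D_eq: "carlitz_D d = carlitz_ell d * (carlitz_c d :: 'a::{field,finite} fls)"
proof (induction d)
  case (Suc d)
  have "carlitz_ell (Suc d) * carlitz_c (Suc d) =
      (bracket (Suc d) :: 'a fls) * ((carlitz_ell d * carlitz_c d) * carlitz_D d ^ (CARD('a) - 1))"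
    by (simp add: carlitz_ell_Suc algebra_simps)
  thus ?case by (simp only: power_card_unfold carlitz_D.simps flip: Suc)
qed simp

text \<open>The q-th power map is additive and fixes constants, so each step of the recursion is
  linear over the finite field.\<close>

lemma carlitz_e_linear:
  fixes x y :: "'a::{field,finite} fls"
  shows "carlitz_e d (x + fls_const c * y) = carlitz_e d x + fls_const c * carlitz_e d y"
  by (induction d) (simp_all add: fls_add_power_card power_mult_distrib fls_const_power_card algebra_simps)

text \<open>Both sides are \<open>t ^ (q ^ (m + k)) - t ^ (q ^ k)\<close>.\<close>

lemma bracket_power: "bracket m ^ (CARD('a) ^ k) = bracket (m + k) - (bracket k :: 'a::{field,finite} fls)"
  by (simp add: bracket_def fls_diff_power_card_power power_add flip: power_mult)

text \<open>Measures how far \<open>carlitz_e (Suc d)\<close> is from commuting with multiplication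
  by \<open>t\<close>; this allows induction from \<open>t ^ d\<close> to
  \<open>t ^ Suc d\<close>.\<close>

lemma carlitz_e_tvar_mult:
  fixes x :: "'a::{field,finite} fls"
  shows "carlitz_e (Suc d) (tvar * x) =
    tvar * carlitz_e (Suc d) x + bracket (Suc d) * carlitz_e d x ^ CARD('a)"
proof (induction d)
  case 0
  show ?case by (simp add: bracket_def power_mult_distrib algebra_simps)
next
  case (Suc d)
  let ?q = "CARD('a)"
  define E1 where "E1 = carlitz_e (Suc d) x"
  define E0 where "E0 = carlitz_e d x"
  define D0 :: "'a fls" where "D0 = carlitz_D d"
  define D1 :: "'a fls" where "D1 = carlitz_D (Suc d)"
  define B :: "'a fls" where "B = bracket (Suc d)"
  have Bq: "B ^ ?q = bracket (Suc (Suc d)) - bracket 1"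
    using bracket_power[where 'a='a, of "Suc d" 1] by (simp add: B_def)
  \<comment> \<open>Follows from \<open>D1 = B * D0 ^ q\<close>. With \<open>Eq\<close> it merges
    the two pure \<open>E0\<close> terms of the expansion into
    \<open>B ^ q * E1 ^ q\<close>.\<close>
  have D: "D1 ^ (?q - 1) * B = B ^ ?q * (D0 ^ (?q - 1)) ^ ?q"
  proof -
    have "D1 ^ (?q - 1) * B = (B * B ^ (?q - 1)) * (D0 ^ (?q - 1)) ^ ?q"
      by (simp add: D1_def D0_def B_def power_mult_distrib mult_ac flip: power_mult)
    thus ?thesis by (simp only: power_card_unfold)
  qed
  have E: "E1 = E0 ^ ?q - D0 ^ (?q - 1) * E0"
    by (simp add: E1_def E0_def D0_def)
  have Eq: "E1 ^ ?q = (E0 ^ ?q) ^ ?q - (D0 ^ (?q - 1)) ^ ?q * E0 ^ ?q"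
    by (simp add: E fls_diff_power_card power_mult_distrib)
  have tq: "tvar ^ ?q = tvar + (bracket 1 :: 'a fls)"
    by (simp add: bracket_def)
  have "carlitz_e (Suc (Suc d)) (tvar * x) =
      (tvar * E1 + B * E0 ^ ?q) ^ ?q - D1 ^ (?q - 1) * (tvar * E1 + B * E0 ^ ?q)"
    by (simp only: carlitz_e.simps(2)[of "Suc d"] Suc E1_def E0_def D1_def B_def)
  also have "\<dots> = tvar ^ ?q * E1 ^ ?q + B ^ ?q * (E0 ^ ?q) ^ ?q
      - tvar * (D1 ^ (?q - 1) * E1) - (D1 ^ (?q - 1) * B) * E0 ^ ?q"
    by (simp add: fls_add_power_card power_mult_distrib algebra_simps)
  also have "\<dots> = tvar * (E1 ^ ?q - D1 ^ (?q - 1) * E1) + bracket 1 * E1 ^ ?q + B ^ ?q * E1 ^ ?q"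
    unfolding D tq Eq by (simp add: algebra_simps)
  \<comment> \<open>The \<open>bracket 1\<close> coming from \<open>tvar ^ q\<close> cancels the one
    in \<open>Bq\<close>.\<close>
  also have "\<dots> = tvar * (E1 ^ ?q - D1 ^ (?q - 1) * E1) + bracket (Suc (Suc d)) * E1 ^ ?q"
    unfolding Bq by (simp add: algebra_simps)
  finally show ?case
    by (simp only: carlitz_e.simps(2)[of "Suc d"] E1_def D1_def)
qed

text \<open>The value \<open>D\<close> at \<open>t ^ d\<close> forces the zero one level up, as
  \<open>D ^ q - D ^ (q - 1) * D = 0\<close>; this zero then removes the first term of
  \<open>carlitz_e_tvar_mult\<close> and yields the next value.\<close>

lemma carlitz_e_power_tvar: "carlitz_e d (tvar ^ d) = (carlitz_D d :: 'a::{field,finite} fls)"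
  and carlitz_e_Suc_power_tvar: "carlitz_e (Suc d) (tvar ^ d) = (0 :: 'a::{field,finite} fls)"
proof -
  have *: "carlitz_e (Suc d) (tvar ^ d) = (0 :: 'a fls)"
    if "carlitz_e d (tvar ^ d) = (carlitz_D d :: 'a fls)" for d
    using that power_card_unfold[of "carlitz_D d :: 'a fls"] by (simp add: mult.commute)
  show "carlitz_e d (tvar ^ d) = (carlitz_D d :: 'a fls)"
  proof (induction d)
    case (Suc d)
    have "carlitz_e (Suc d) (tvar ^ Suc d) =
        tvar * carlitz_e (Suc d) (tvar ^ d) + bracket (Suc d) * (carlitz_e d (tvar ^ d) :: 'a fls) ^ CARD('a)"
      by (simp only: carlitz_e_tvar_mult power_Suc)
    thus ?case by (simp only: *[OF Suc] Suc carlitz_D.simps mult_zero_right add_0)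
  qed simp
  thus "carlitz_e (Suc d) (tvar ^ d) = (0 :: 'a fls)" by (rule *)
qed

section \<open>Sums over all polynomials of degree below a bound\<close>

lemma poly_embed_add: "poly_embed (a + b) = poly_embed a + poly_embed b"
  by (rule fls_eqI) (simp add: poly_embed_nth)

lemma poly_embed_monom: "poly_embed (monom c d) = fls_const c * tvar ^ d"
  by (simp add: poly_embed_def map_poly_monom poly_monom)

text \<open>The condition \<open>degree b < d\<close> would exclude the zero polynomial at
  \<open>d = 0\<close>, where the induction starts from the set \<open>{0}\<close>.\<close>

definition low_polys :: "nat \<Rightarrow> 'a::field poly set" where
  "low_polys d = {b. \<forall>i\<ge>d. coeff b i = 0}"

lemma sum_low_polys_Suc:
  "(\<Sum>b\<in>low_polys (Suc d). f b) = (\<Sum>c\<in>UNIV. \<Sum>b\<in>low_polys d. f (monom c d + b))"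
proof -
  have "(\<Sum>b\<in>low_polys (Suc d). f b) = (\<Sum>(c, b)\<in>UNIV \<times> low_polys d. f (monom c d + b))"
    by (rule sum.reindex_bij_witness[of _ "\<lambda>(c, b). monom c d + b"
          "\<lambda>p. (coeff p d, p - monom (coeff p d) d)"])
       (auto simp: low_polys_def Suc_le_eq)
  thus ?thesis by (simp add: sum.cartesian_product)
qed

lemma sum_monic_polys:
  fixes f :: "'a::field poly \<Rightarrow> 'b::comm_monoid_add"
  shows "(\<Sum>a\<in>monic_polys d. f a) = (\<Sum>b\<in>low_polys d. f (monom 1 d + b))"
proof (rule sum.reindex_bij_witness[of _ "\<lambda>b. monom 1 d + b" "\<lambda>a. a - monom 1 d"])
  fix a :: "'a poly" assume a: "a \<in> monic_polys d"
  thus "a - monom 1 d \<in> low_polys d"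
    by (auto simp: low_polys_def monic_polys_def le_eq_less_or_eq coeff_eq_0)
next
  fix b :: "'a poly" assume b: "b \<in> low_polys d"
  have "degree (monom 1 d + b) = d"
  proof (rule antisym)
    show "degree (monom 1 d + b) \<le> d" using b by (intro degree_le) (auto simp: low_polys_def)
    show "d \<le> degree (monom 1 d + b)" using b by (intro le_degree) (auto simp: low_polys_def)
  qed
  thus "monom 1 d + b \<in> monic_polys d"
    using b by (auto simp: low_polys_def monic_polys_def)
qed auto

text \<open>Splitting off the coefficient \<open>c\<close> of \<open>t ^ d\<close> shifts
  \<open>y\<close> by \<open>c * t ^ d\<close>, hence \<open>carlitz_e d y\<close> by
  \<open>c * carlitz_D d\<close>; what remains is a sum over constants.\<close>

lemma sum_low_polys:
  fixes y :: "'a::{field,finite} fls"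
  assumes "k = 1 \<or> k = CARD('a) - 1" "carlitz_e d y \<noteq> 0"
  shows "(\<Sum>b\<in>low_polys d. 1 / (y + poly_embed b) ^ k) = (carlitz_c d / carlitz_e d y) ^ k"
  using assms(2)
proof (induction d arbitrary: y)
  case 0
  have "low_polys 0 = {0 :: 'a poly}" by (auto simp: low_polys_def poly_eq_iff)
  moreover have "poly_embed (0 :: 'a poly) = 0" by (simp add: poly_embed_def)
  ultimately show ?case by (simp add: power_divide)
next
  case (Suc d)
  let ?q = "CARD('a)" and ?Y = "carlitz_e d y" and ?D = "carlitz_D d :: 'a fls"
  \<comment> \<open>A zero of \<open>carlitz_e d\<close> is one of \<open>carlitz_e (Suc d)\<close>,
    which is invariant under shifts by \<open>c * t ^ d\<close>.\<close>
  have nz: "carlitz_e d (y + fls_const c * tvar ^ d) \<noteq> 0" for c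
  proof
    assume "carlitz_e d (y + fls_const c * tvar ^ d) = 0"
    hence "carlitz_e (Suc d) (y + fls_const c * tvar ^ d) = 0"
      using card_gt_1[where 'a='a] by (simp add: power_0_left)
    thus False
      using Suc.prems by (simp only: carlitz_e_linear carlitz_e_Suc_power_tvar) simp
  qed
  have "(\<Sum>b\<in>low_polys (Suc d). 1 / (y + poly_embed b) ^ k) =
      (\<Sum>c\<in>UNIV. \<Sum>b\<in>low_polys d. 1 / ((y + fls_const c * tvar ^ d) + poly_embed b) ^ k)"
    by (simp add: sum_low_polys_Suc poly_embed_add poly_embed_monom add.assoc)
  also have "\<dots> = (\<Sum>c\<in>UNIV. (carlitz_c d / (?Y + fls_const c * ?D)) ^ k)"
    by (simp only: Suc.IH[OF nz] carlitz_e_linear carlitz_e_power_tvar)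
  also have "\<dots> = carlitz_c d ^ k * (\<Sum>c\<in>UNIV. 1 / (?Y + fls_const c * ?D) ^ k)"
    by (simp add: power_divide sum_distrib_left)
  also have "\<dots> = carlitz_c d ^ k * (- (?D ^ (?q - 1)) / carlitz_e (Suc d) y) ^ k"
    using Suc.prems by (subst sum_inverse_power_add_const_mult[OF _ _ assms(1)]) auto
  also have "\<dots> = (carlitz_c (Suc d) / carlitz_e (Suc d) y) ^ k"
    by (simp add: mult.commute flip: power_mult_distrib)
  finally show ?case .
qed

lemma power_sum_eq_ell:
  assumes "k = 1 \<or> k = CARD('a) - 1"
  shows "power_sum d k = 1 / (carlitz_ell d :: 'a::{field,finite} fls) ^ k"
proof -
  have "power_sum d k = (\<Sum>b\<in>low_polys d. 1 / (tvar ^ d + poly_embed b :: 'a fls) ^ k)"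
    by (simp add: power_sum_def sum_monic_polys poly_embed_add poly_embed_monom)
  also have "\<dots> = (carlitz_c d / carlitz_D d) ^ k"
    by (subst sum_low_polys[OF assms]) (simp_all add: carlitz_e_power_tvar)
  also have "carlitz_c d / carlitz_D d = 1 / (carlitz_ell d :: 'a fls)"
    using carlitz_D_nonzero[of d, where 'a='a] by (simp add: carlitz_D_eq)
  finally show ?thesis by (simp add: power_divide)
qed

lemma power_sum_frobenius:
  "power_sum d (m * CARD('a) ^ k) = (power_sum d m :: 'a::{field,finite} fls) ^ (CARD('a) ^ k)"
  by (simp add: power_sum_def fls_sum_power_card_power power_divide flip: power_mult)

section \<open>Truncated multizeta sums\<close>

text \<open>The nested form makes the passage from \<open>N\<close> to \<open>N + 1\<close> add a
  single term, as telescoping requires.\<close>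

primrec multizeta_below :: "nat list \<Rightarrow> nat \<Rightarrow> 'a::{field,finite} fls" where
  "multizeta_below [] N = 1"
| "multizeta_below (s # ss) N = (\<Sum>d<N. power_sum d s * multizeta_below ss d)"

definition decreasing_lists_below :: "nat \<Rightarrow> nat \<Rightarrow> nat list set" where
  "decreasing_lists_below r N = {ds \<in> decreasing_lists r. set ds \<subseteq> {..<N}}"

lemma finite_decreasing_lists_below: "finite (decreasing_lists_below r N)"
  by (rule finite_subset[OF _ finite_lists_length_eq[of "{..<N}" r]])
     (auto simp: decreasing_lists_below_def decreasing_lists_def)

text \<open>The head of a decreasing list is a strict bound for its tail, which matches the nesting
  of the sums.\<close>

lemma multizeta_below_eq_sum:
  "(multizeta_below s N :: 'a::{field,finite} fls) =
    (\<Sum>ds\<in>decreasing_lists_below (length s) N. multizeta_term s ds)"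
proof (induction s arbitrary: N)
  case Nil
  have "decreasing_lists_below 0 N = {[]}"
    by (auto simp: decreasing_lists_below_def decreasing_lists_def)
  thus ?case by (simp add: multizeta_term_def)
next
  case (Cons s ss)
  let ?L = "decreasing_lists_below (length ss)"
  have "(multizeta_below (s # ss) N :: 'a fls) =
      (\<Sum>(d, ds)\<in>Sigma {..<N} ?L. power_sum d s * multizeta_term ss ds)"
    by (simp add: Cons sum_distrib_left sum.Sigma finite_decreasing_lists_below)
  also have "\<dots> = (\<Sum>ds\<in>decreasing_lists_below (length (s # ss)) N. multizeta_term (s # ss) ds)"
  proof (rule sum.reindex_bij_witness[of _ "\<lambda>ds. (hd ds, tl ds)" "\<lambda>(d, ds). d # ds"])
    fix ds assume ds: "ds \<in> decreasing_lists_below (length (s # ss)) N"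
    then obtain x xs where "ds = x # xs"
      by (cases ds) (auto simp: decreasing_lists_below_def decreasing_lists_def)
    with ds show "(hd ds, tl ds) \<in> Sigma {..<N} ?L" "(case (hd ds, tl ds) of (d, ds) \<Rightarrow> d # ds) = ds"
      by (auto simp: decreasing_lists_below_def decreasing_lists_def)
  next
    fix x assume "x \<in> Sigma {..<N} ?L"
    thus "(case x of (d, ds) \<Rightarrow> d # ds) \<in> decreasing_lists_below (length (s # ss)) N"
      by (fastforce simp: decreasing_lists_below_def decreasing_lists_def)
  qed (auto simp: multizeta_term_def prod.lessThan_Suc_shift simp del: prod.lessThan_Suc)
  finally show ?case .
qed

text \<open>The truncated index sets are finite and eventually contain any given finite set of
  decreasing lists, so the unconditional sum is the limit along them.\<close>

lemma multizeta_below_tendsto: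
  assumes "\<forall>x\<in>set s. x > 0"
  shows "multizeta_below s \<longlonglongrightarrow> (multizeta s :: 'a::{field,finite} fls)"
proof -
  have "filterlim (decreasing_lists_below (length s))
      (finite_subsets_at_top (decreasing_lists (length s))) sequentially"
    unfolding filterlim_finite_subsets_at_top
  proof clarify
    fix X assume X: "finite X" "X \<subseteq> decreasing_lists (length s)"
    then obtain M where M: "(\<Union>ds\<in>X. set ds) \<subseteq> {..<M}"
      using finite_nat_set_iff_bounded[of "\<Union>ds\<in>X. set ds"] by auto
    show "\<forall>\<^sub>F N in sequentially. finite (decreasing_lists_below (length s) N) \<and>
        X \<subseteq> decreasing_lists_below (length s) N \<and>
        decreasing_lists_below (length s) N \<subseteq> decreasing_lists (length s)"
      using eventually_ge_at_top[of M]
    proof eventually_elim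
      case (elim N)
      thus ?case using X M finite_decreasing_lists_below
        by (fastforce simp: decreasing_lists_below_def)
    qed
  qed
  moreover have "((multizeta_term s :: _ \<Rightarrow> 'a fls) has_sum multizeta s) (decreasing_lists (length s))"
    unfolding multizeta_def by (rule has_sum_infsum[OF multizeta_summable[OF assms]])
  ultimately have "(\<lambda>N. \<Sum>ds\<in>decreasing_lists_below (length s) N. multizeta_term s ds)
      \<longlonglongrightarrow> (multizeta s :: 'a fls)"
    unfolding has_sum_def by (rule filterlim_compose[rotated])
  thus ?thesis by (simp add: multizeta_below_eq_sum[abs_def])
qed

lemma dist_fls_eq_power_int:
  "a \<noteq> b \<Longrightarrow> dist a b = 2 powi (- fls_subdegree (a - b :: 'a::field fls))"
  by (simp add: dist_fls_def power_int_def power_one_over inverse_eq_divide)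

text \<open>Subdegrees add under multiplication. Multiplying by \<open>c\<close> thus scales all
  distances by one factor, which gives continuity.\<close>

lemma dist_fls_mult_left:
  fixes a b c :: "'a::field fls"
  shows "dist (c * a) (c * b) = dist c 0 * dist a b"
proof (cases "c = 0 \<or> a = b")
  case False
  have "c * a - c * b = c * (a - b)" by (simp add: algebra_simps)
  thus ?thesis using False
    using power_int_add[of "2 :: real" "- fls_subdegree c" "- fls_subdegree (a - b)"]
    by (simp add: dist_fls_eq_power_int)
qed auto

lemma tendsto_fls_mult_left:
  fixes c l :: "'a::field fls"
  assumes "(f \<longlongrightarrow> l) F"
  shows "((\<lambda>x. c * f x) \<longlongrightarrow> c * l) F"
  using tendsto_mult_right_zero[of "\<lambda>x. dist (f x) l" F "dist c 0"] assms
  by (simp add: tendsto_dist_iff[of _ l] tendsto_dist_iff[of _ "c * l"] dist_fls_mult_left)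

lemma multizeta_below_frobenius:
  "multizeta_below (map (\<lambda>x. x * CARD('a)) s) N = (multizeta_below s N :: 'a::{field,finite} fls) ^ CARD('a)"
proof (induction s arbitrary: N)
  case (Cons x s)
  thus ?case using power_sum_frobenius[where 'a='a, of _ x 1]
    by (simp add: fls_sum_power_card power_mult_distrib)
qed simp


section \<open>The telescoping evaluation\<close>

definition thakur_const :: "nat \<Rightarrow> 'a::{field,finite} fls" where
  "thakur_const n = (- 1) ^ n / (\<Prod>i=1..n. bracket i ^ (CARD('a) ^ (n - i)))"

lemma thakur_const_0: "thakur_const 0 = 1"
  by (simp add: thakur_const_def)

text \<open>The q-th power raises each exponent \<open>q ^ (n - i)\<close> to
  \<open>q ^ (Suc n - i)\<close>; only the factor for \<open>i = Suc n\<close>, with exponent 1, and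
  one sign are then missing.\<close>

lemma thakur_const_Suc:
  "thakur_const n ^ CARD('a) = - bracket (Suc n) * (thakur_const (Suc n) :: 'a::{field,finite} fls)"
proof -
  have "(\<Prod>i=1..n. bracket i ^ (CARD('a) ^ (n - i)) :: 'a fls) ^ CARD('a) =
      (\<Prod>i=1..n. bracket i ^ (CARD('a) ^ (Suc n - i)))"
    by (simp add: Suc_diff_le mult.commute[of "CARD('a)"] prod_power_distrib power_mult)
  moreover have "((- 1) ^ n) ^ CARD('a) = (- 1 :: 'a fls) ^ n"
    by (metis fls_minus_power_card mult.commute power_mult power_one)
  ultimately show ?thesis
    using bracket_nonzero[of "Suc n", where 'a='a]
    by (simp add: thakur_const_def power_divide)
qed

text \<open>Induction on \<open>n\<close>, and inside it on \<open>d\<close>: both sides grow by the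
  same amount \<open>X\<close> from \<open>d\<close> to \<open>Suc d\<close>. Below \<open>n\<close>
  there is no decreasing list of length \<open>n\<close>, hence the value 0.\<close>

lemma multizeta_below_eq:
  "multizeta_below (map (\<lambda>i. (CARD('a) - 1) * CARD('a) ^ i) [0..<n]) d =
    (if d < n then 0
     else thakur_const n * carlitz_ell d / (carlitz_ell (d - n) :: 'a::{field,finite} fls) ^ (CARD('a) ^ n))"
proof (induction n arbitrary: d)
  case 0
  show ?case by (simp add: thakur_const_0)
next
  case (Suc n)
  note IH = Suc.IH
  let ?q = "CARD('a)" and ?ell = "carlitz_ell :: nat \<Rightarrow> 'a fls"
  let ?L = "\<lambda>n. map (\<lambda>i. (?q - 1) * ?q ^ i) [0..<n]"
  let ?C = "thakur_const (Suc n) :: 'a fls" and ?Q = "?q ^ Suc n"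
  \<comment> \<open>The tail is the shorter list with all entries multiplied by \<open>q\<close>, so
    by Frobenius its truncated sum is a q-th power.\<close>
  have L: "?L (Suc n) = (?q - 1) # map (\<lambda>x. x * ?q) (?L n)"
    by (simp add: map_upt_Suc mult_ac del: upt_Suc)
  show ?case
  proof (induction d)
    case 0
    show ?case unfolding L by simp
  next
    case (Suc d)
    define X :: "'a fls" where "X = power_sum d (?q - 1) * multizeta_below (?L n) d ^ ?q"
    have step: "multizeta_below (?L (Suc n)) (Suc d) = multizeta_below (?L (Suc n)) d + X"
      unfolding L X_def by (simp only: multizeta_below.simps sum.lessThan_Suc multizeta_below_frobenius)
    have X: "X = - bracket (Suc n) * ?C * ?ell d / ?ell (d - n) ^ ?Q" if "n \<le> d"
    proof -
      have "X = thakur_const n ^ ?q * (?ell d ^ ?q / ?ell d ^ (?q - 1)) / ?ell (d - n) ^ ?Q"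
        using that unfolding X_def IH
        by (simp add: power_sum_eq_ell power_mult_distrib power_divide mult_ac flip: power_mult)
      also have "?ell d ^ ?q / ?ell d ^ (?q - 1) = ?ell d"
        by (simp flip: power_card_unfold)
      finally show ?thesis by (simp add: thakur_const_Suc)
    qed
    consider "d < n" | "d = n" | m where "d = Suc n + m"
      by (metis less_iff_Suc_add linorder_neqE_nat add_Suc)
    thus ?case
    proof cases
      case 1
      thus ?thesis unfolding step Suc.IH X_def IH
        by (simp add: power_0_left)
    next
      \<comment> \<open>The first nonzero value: the denominator is
        \<open>carlitz_ell 0 = 1\<close>, and \<open>- bracket (Suc n)\<close> extends
        \<open>carlitz_ell n\<close> to \<open>carlitz_ell (Suc n)\<close>.\<close>
      case 2
      thus ?thesis unfolding step Suc.IH X[OF eq_refl[OF 2[symmetric]]]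
        by (simp add: carlitz_ell_Suc)
    next
      case (3 m)
      \<comment> \<open>\<open>W\<close> brings both terms to the denominator
        \<open>carlitz_ell (Suc m) ^ Q\<close>. By \<open>bracket_power\<close> its part
        \<open>bracket (Suc n)\<close> cancels against \<open>X\<close>, and
        \<open>- bracket (Suc d)\<close> extends \<open>carlitz_ell d\<close>.\<close>
      define W where "W = (- bracket (Suc m) :: 'a fls) ^ ?Q"
      have W: "W = bracket (Suc n) - bracket (Suc d)"
        using fls_diff_power_card_power[of 0 "bracket (Suc m) :: 'a fls" "Suc n"]
        unfolding W_def bracket_power by (simp add: 3 power_0_left add_ac)
      have W0: "W \<noteq> 0" by (simp add: W_def bracket_nonzero)
      have ellW: "?ell (Suc m) ^ ?Q = W * ?ell m ^ ?Q"
        by (simp only: carlitz_ell_Suc W_def power_mult_distrib)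
      have "multizeta_below (?L (Suc n)) (Suc d) =
          ?C * ?ell d / ?ell m ^ ?Q + - bracket (Suc n) * ?C * ?ell d / ?ell (Suc m) ^ ?Q"
        unfolding step Suc.IH using X 3 by simp
      also have "?C * ?ell d / ?ell m ^ ?Q = W * ?C * ?ell d / ?ell (Suc m) ^ ?Q"
        unfolding ellW using W0 by simp
      also have "W * ?C * ?ell d / ?ell (Suc m) ^ ?Q + - bracket (Suc n) * ?C * ?ell d / ?ell (Suc m) ^ ?Q =
          ?C * ?ell (Suc d) / ?ell (Suc m) ^ ?Q"
        unfolding W carlitz_ell_Suc[of d] by (simp add: algebra_simps flip: add_divide_distrib)
      finally show ?thesis using 3 by (simp del: upt_Suc)
    qed
  qed
qed

text \<open>The terms with \<open>d < n\<close> vanish. In the others \<open>power_sum d 1\<close>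
  cancels the numerator \<open>carlitz_ell d\<close>, and the shift by \<open>n\<close> accounts for
  the bounds \<open>N + n\<close> and \<open>N\<close>.\<close>

lemma multizeta_below_telescope:
  "multizeta_below (1 # map (\<lambda>i. (CARD('a) - 1) * CARD('a) ^ i) [0..<n]) (N + n) =
    thakur_const n * (multizeta_below [CARD('a) ^ n] N :: 'a::{field,finite} fls)"
proof -
  let ?L = "map (\<lambda>i. (CARD('a) - 1) * CARD('a) ^ i) [0..<n]"
  let ?f = "\<lambda>d. power_sum d 1 * multizeta_below ?L d :: 'a fls"
  have "multizeta_below (1 # ?L) (N + n) = (\<Sum>d<n. ?f d) + (\<Sum>d=n..<N + n. ?f d)"
    using sum.atLeastLessThan_concat[of 0 n "N + n" ?f] by (simp add: atLeast0LessThan)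
  also have "(\<Sum>d<n. ?f d) = 0"
    by (simp add: multizeta_below_eq del: One_nat_def)
  also have "(\<Sum>d=n..<N + n. ?f d) = (\<Sum>d<N. ?f (d + n))"
    using sum.shift_bounds_nat_ivl[of ?f 0 n N] by (simp add: atLeast0LessThan)
  \<comment> \<open>The factor 1 in the exponent exposes the shape that
    \<open>power_sum_frobenius\<close> rewrites.\<close>
  also have "\<dots> = (\<Sum>d<N. thakur_const n * (power_sum d (1 * CARD('a) ^ n) :: 'a fls))"
    unfolding power_sum_frobenius
    by (simp add: multizeta_below_eq power_sum_eq_ell power_divide del: One_nat_def)
  finally show ?thesis by (simp add: sum_distrib_left)
qed

theorem theorem3p2:
  fixes n q :: nat
  assumes "q = CARD('a::{field,finite})"
  shows "(multizeta (1 # map (\<lambda>i. (q - 1) * q ^ i) [0..<n + 1]) :: 'a fls) =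
    (-1) ^ (n + 1) / (\<Prod>i=1..n + 1. bracket i ^ (q ^ (n + 1 - i))) * multizeta [q ^ (n + 1)]"
proof -
  let ?s = "1 # map (\<lambda>i. (q - 1) * q ^ i) [0..<n + 1]"
  \<comment> \<open>Makes all exponents \<open>(q - 1) * q ^ i\<close> positive, as convergence
    requires.\<close>
  have q: "q > 1" using assms card_gt_1[where 'a='a] by simp
  have "(\<lambda>N. multizeta_below ?s (N + (n + 1))) \<longlonglongrightarrow> (multizeta ?s :: 'a fls)"
    by (rule LIMSEQ_ignore_initial_segment, rule multizeta_below_tendsto) (use q in auto)
  moreover have "(\<lambda>N. thakur_const (n + 1) * multizeta_below [q ^ (n + 1)] N)
      \<longlonglongrightarrow> thakur_const (n + 1) * (multizeta [q ^ (n + 1)] :: 'a fls)"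
    by (intro tendsto_fls_mult_left multizeta_below_tendsto) (use q in auto)
  ultimately have "multizeta ?s = thakur_const (n + 1) * (multizeta [q ^ (n + 1)] :: 'a fls)"
    unfolding assms multizeta_below_telescope by (rule LIMSEQ_unique)
  thus ?thesis by (simp only: thakur_const_def assms)
qed

end
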